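(* For all integers $k,\ell \geq 1$, $$Q_{132}^{(0,k,\ell,0)}(t,x) = \frac{C_{k-1} t^{k-1} + \sum_{j=0}^{k-2} C_j t^j \left(1 -tQ_{132}^{(0,0,\ell,0)}(t,x) +t\left(Q_{132}^{(0,k-j-1,\ell,0)}(t,x)-\sum_{s=0}^{k-j-2}C_s t^s\right)\right)}{1-tQ_{132}^{(0,0,\ell,0)}(t,x)}$$ as formal power series in $t$ with coefficients in $\mathbb{Z}[x]$, where empty sums are $0$.
   Context: Let $\mathbb{N}=\{0,1,2,\ldots\}$ and let $S_n$ be the set of permutations $\sigma=\sigma_1\cdots\sigma_n$ of $\{1,\ldots,n\}$ in one-line notation. $S_n(132)$ denotes the set of $\sigma\in S_n$ that avoid the pattern $132$, i.e. there are no indices $i_1<i_2<i_3$ with $\sigma_{i_1}<\sigma_{i_3}<\sigma_{i_2}$. For $a,b,c,d\in\mathbb{N}$ and $\sigma\in S_n$, say that $\sigma_i$ matches the quadrant marked mesh pattern $\mathrm{MMP}(a,b,c,d)$ in $\sigma$ if: at least $a$ indices $j>i$ have $\sigma_j>\sigma_i$; at least $b$ indices $j<i$ have $\sigma_j>\sigma_i$; at least $c$ indices $j<i$ have $\sigma_j<\sigma_i$; and at least $d$ indices $j>i$ have $\sigma_j<\sigma_i$. Let $\mathrm{mmp}^{(a,b,c,d)}(\sigma)$ be the number of $i$ such that $\sigma_i$ matches $\mathrm{MMP}(a,b,c,d)$ in $\sigma$. Define $Q_{n,132}^{(a,b,c,d)}(x)=\sum_{\sigma\in S_n(132)}x^{\mathrm{mmp}^{(a,b,c,d)}(\sigma)}$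 for $n\geq 1$, and $Q_{132}^{(a,b,c,d)}(t,x)=1+\sum_{n\geq 1}t^n Q_{n,132}^{(a,b,c,d)}(x)$. $C_n=\frac{1}{n+1}\binom{2n}{n}$ is the $n$-th Catalan number. *)

theory Defs
  imports
    "HOL-Computational_Algebra.Polynomial"
    "HOL-Computational_Algebra.Formal_Power_Series"
    "HOL-Combinatorics.Multiset_Permutations"
begin

definition avoids_132 :: "nat list \<Rightarrow> bool" where
  "avoids_132 \<sigma> \<longleftrightarrow>
     \<not> (\<exists>i1 i2 i3. i1 < i2 \<and> i2 < i3 \<and> i3 < length \<sigma> \<and>
          \<sigma> ! i1 < \<sigma> ! i3 \<and> \<sigma> ! i3 < \<sigma> ! i2)"

(* Permutations are one-line words over {1..n}; positions are counted from 0. *)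
definition S132 :: "nat \<Rightarrow> nat list set" where
  "S132 n = {\<sigma> \<in> permutations_of_set {1..n}. avoids_132 \<sigma>}"

definition matches_MMP ::
    "nat \<Rightarrow> nat \<Rightarrow> nat \<Rightarrow> nat \<Rightarrow> nat list \<Rightarrow> nat \<Rightarrow> bool" where
  "matches_MMP a b c d \<sigma> i \<longleftrightarrow>
     a \<le> card {j. i < j \<and> j < length \<sigma> \<and> \<sigma> ! j > \<sigma> ! i} \<and>
     b \<le> card {j. j < i \<and> \<sigma> ! j > \<sigma> ! i} \<and>
     c \<le> card {j. j < i \<and> \<sigma> ! j < \<sigma> ! i} \<and>
     d \<le> card {j. i < j \<and> j < length \<sigma> \<and> \<sigma> ! j < \<sigma> ! i}"

definition mmp :: "nat \<Rightarrow> nat \<Rightarrow> nat \<Rightarrow> nat \<Rightarrow> nat list \<Rightarrow> nat" where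
  "mmp a b c d \<sigma> = card {i. i < length \<sigma> \<and> matches_MMP a b c d \<sigma> i}"

(* The polynomial variable is x, so monom 1 m is x^m. *)
definition Qpoly :: "nat \<Rightarrow> nat \<Rightarrow> nat \<Rightarrow> nat \<Rightarrow> nat \<Rightarrow> int poly" where
  "Qpoly a b c d n = (\<Sum>\<sigma>\<in>S132 n. monom 1 (mmp a b c d \<sigma>))"

(* The power series variable is t, written fps_X. *)
definition Q132 :: "nat \<Rightarrow> nat \<Rightarrow> nat \<Rightarrow> nat \<Rightarrow> int poly fps" where
  "Q132 a b c d = Abs_fps (\<lambda>n. if n = 0 then 1 else Qpoly a b c d n)"

definition catalan :: "nat \<Rightarrow> nat" where
  "catalan n = ((2 * n) choose n) div (n + 1)"

lemma catalan_exact: "(n + 1) * catalan n = (2 * n) choose n"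
proof -
  have "(n + 1) * ((2 * n) choose (n + 1)) = n * ((2 * n) choose n)"
    using binomial_absorb_comp[of "2 * n" n] binomial_absorption[of n "2 * n"]
    by (cases n) (simp_all del: binomial_Suc_Suc)
  then have "((2 * n) choose n) + (n + 1) * ((2 * n) choose (n + 1)) = (n + 1) * ((2 * n) choose n)"
    by simp
  then have "(n + 1) dvd ((2 * n) choose n)"
    by (metis dvd_add_left_iff dvd_triv_left)
  then show ?thesis
    unfolding catalan_def by (rule dvd_mult_div_cancel)
qed

(* Division of power series is available in the library only over coefficient types
   with an inverse operation, which int poly lacks. A series with constant coefficient 1
   is a unit; fps_right_inverse f 1 is then its inverse. *)
definition fps_inverse_one :: "'a::comm_ring_1 fps \<Rightarrow> 'a fps" where
  "fps_inverse_one f = fps_right_inverse f 1"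

lemma fps_inverse_one: "fps_nth f 0 = 1 \<Longrightarrow> f * fps_inverse_one f = 1"
  unfolding fps_inverse_one_def by (rule fps_right_inverse) simp

lemma denominator_unit:
  "(1 - fps_X * F) * fps_inverse_one (1 - fps_X * F) = 1"
  for F :: "'a::comm_ring_1 fps"
  by (rule fps_inverse_one) simp

end

theory Submission
  imports Defs
begin

text \<open>
  Cut a 132-avoiding permutation of \<open>{1..n + 1}\<close> at its maximum: \<open>\<sigma> = \<alpha>' (n + 1) \<beta>\<close>. Avoidance
  forces every entry of \<open>\<alpha>'\<close> to exceed every entry of \<open>\<beta>\<close>, since a smaller entry before the
  maximum and a larger one behind it would form the pattern 132. So \<open>\<sigma>\<close> amounts to an
  arbitrary pair of 132-avoiding permutations \<open>\<alpha>\<close>, \<open>\<beta>\<close> whose lengths \<open>j\<close> and \<open>n - j\<close> add up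
  to \<open>n\<close> (\<open>sum_S132_Suc\<close>).

  The condition \<open>MMP(0,k,l,0)\<close> only looks to the left. Entries of \<open>\<alpha>\<close> see just \<open>\<alpha>\<close>; the maximum
  has nothing larger to its left and does not match for \<open>k \<ge> 1\<close>; an entry of \<open>\<beta>\<close> sees
  \<open>j + 1\<close> additional larger entries and no additional smaller ones, so it matches in \<open>\<sigma>\<close> iff it
  matches \<open>MMP(0,k-j-1,l,0)\<close> in \<open>\<beta>\<close>, where the subtraction is truncated at 0 (\<open>mmp_glue\<close>). With
  \<open>Q\<^sub>k\<close> for the series of \<open>MMP(0,k,l,0)\<close> and \<open>q\<^sub>k(j)\<close> for its coefficients, this gives
  \<open>Q\<^sub>k = 1 + t (\<Sum>j. q\<^sub>k(j) t^j Q\<^bsub>k-j-1\<^esub>)\<close>. A permutation of length at most \<open>k\<close>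
  has no match, so \<open>q\<^sub>k(j)\<close> is a Catalan number for \<open>j < k - 1\<close>, while all \<open>j \<ge> k - 1\<close>
  share the factor \<open>Q\<^sub>0\<close>. This is the equation \<open>Q132_functional_equation\<close>, linear in \<open>Q\<^sub>k\<close>.

  Solving it gives a numerator that differs in form from the stated one. The two agree by
  the Catalan recurrence applied to truncated Catalan series (\<open>catalan_trunc_Suc\<close>). The recurrence
  has to be proved for the binomial formula, which also identifies the number of 132-avoiding
  permutations (\<open>card_S132\<close>).
\<close>

section \<open>The Catalan convolution\<close>

lemma catalan_0 [simp]: "catalan 0 = 1"
  by (simp add: catalan_def)

lemma catalan_Suc: "(n + 2) * catalan (Suc n) = (4 * n + 2) * catalan n"
proof -
  have "Suc n * ((2 * Suc n) choose Suc n) = Suc n * (2 * (Suc (2 * n) choose n))"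
    using binomial_absorption[of n "2 * Suc n"] by (simp del: binomial_Suc_Suc)
  then have "(2 * Suc n) choose Suc n = 2 * (Suc (2 * n) choose n)"
    by (simp only: mult_cancel1) simp
  moreover have "Suc n * (Suc (2 * n) choose n) = Suc (2 * n) * ((2 * n) choose n)"
    using binomial_absorb_comp[of "Suc (2 * n)" n] by (simp del: binomial_Suc_Suc)
  ultimately have "Suc n * ((2 * Suc n) choose Suc n) = 2 * (Suc (2 * n) * ((2 * n) choose n))"
    by (simp only: mult.left_commute[of "Suc n" 2])
  then have "Suc n * ((n + 2) * catalan (Suc n)) = 2 * (Suc (2 * n) * ((n + 1) * catalan n))"
    using catalan_exact[of n] catalan_exact[of "Suc n"] by (simp del: binomial_Suc_Suc)
  also have "\<dots> = Suc n * ((4 * n + 2) * catalan n)"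
    by (simp add: algebra_simps)
  finally show ?thesis
    by (simp only: mult_cancel1) simp
qed

text \<open>
  Write \<open>S m\<close> for the convolution sum. By the symmetry \<open>i \<leftrightarrow> m - i\<close>, weighting its terms by \<open>i\<close>
  multiplies it by \<open>m / 2\<close>. Applying the two-term recurrence \<open>catalan_Suc\<close> to the first factor
  of the sum weighted by \<open>i + 1\<close> therefore turns it into an expression in \<open>S (m - 1)\<close>, giving
  \<open>(m + 2) S m = 2 C m + 4 m S (m - 1)\<close>. Once \<open>S (m - 1) = C m\<close> is known, the right-hand side is
  \<open>(4 m + 2) C m\<close>, and the two-term recurrence yields \<open>S m = C (m + 1)\<close>.
\<close>
lemma catalan_convolution: "(\<Sum>i\<le>n. catalan i * catalan (n - i)) = catalan (Suc n)"
proof (induction n)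
  case 0
  then show ?case using catalan_Suc[of 0] by simp
next
  case (Suc n)
  have symm: "2 * (\<Sum>i\<le>m. i * (catalan i * catalan (m - i)))
      = m * (\<Sum>i\<le>m. catalan i * catalan (m - i))" for m
  proof -
    have "(\<Sum>i\<le>m. i * (catalan i * catalan (m - i)))
        = (\<Sum>i\<le>m. (m - i) * (catalan i * catalan (m - i)))"
      by (rule sum.reindex_bij_witness[of _ "\<lambda>i. m - i" "\<lambda>i. m - i"]) auto
    then have "2 * (\<Sum>i\<le>m. i * (catalan i * catalan (m - i)))
        = (\<Sum>i\<le>m. i * (catalan i * catalan (m - i)) + (m - i) * (catalan i * catalan (m - i)))"
      by (simp add: sum.distrib)
    also have "\<dots> = (\<Sum>i\<le>m. m * (catalan i * catalan (m - i)))"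
      by (rule sum.cong) (auto simp flip: add_mult_distrib)
    finally show ?thesis by (simp add: sum_distrib_left)
  qed
  let ?S = "\<lambda>m. \<Sum>i\<le>m. catalan i * catalan (m - i)"
  have "(n + 3) * ?S (Suc n) = 2 * (\<Sum>i\<le>Suc n. (i + 1) * catalan i * catalan (Suc n - i))"
    using symm[of "Suc n"] by (simp only: add_mult_distrib sum.distrib mult.assoc add_mult_distrib2) simp
  also have "(\<Sum>i\<le>Suc n. (i + 1) * catalan i * catalan (Suc n - i))
      = catalan (Suc n) + (\<Sum>i\<le>n. (i + 2) * catalan (Suc i) * catalan (n - i))"
    by (subst sum.atMost_Suc_shift) simp
  also have "(\<Sum>i\<le>n. (i + 2) * catalan (Suc i) * catalan (n - i))
      = (\<Sum>i\<le>n. 4 * (i * (catalan i * catalan (n - i))) + 2 * (catalan i * catalan (n - i)))"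
    by (rule sum.cong[OF refl], subst catalan_Suc) (simp add: algebra_simps)
  also have "\<dots> = 2 * (2 * (\<Sum>i\<le>n. i * (catalan i * catalan (n - i)))) + 2 * ?S n"
    by (simp add: sum.distrib sum_distrib_left)
  also have "\<dots> = (2 * n + 2) * catalan (Suc n)"
    unfolding symm Suc.IH by (simp add: algebra_simps)
  also have "2 * (catalan (Suc n) + (2 * n + 2) * catalan (Suc n)) = (n + 3) * catalan (Suc (Suc n))"
    using catalan_Suc[of "Suc n"] by (simp add: algebra_simps)
  finally have "(n + 3) * ?S (Suc n) = (n + 3) * catalan (Suc (Suc n))" .
  then show ?case
    by (simp only: mult_cancel1) simp
qed

section \<open>Cutting a 132-avoiding permutation at its maximum\<close>

text \<open>
  The inverse of cutting at the maximum: \<open>\<alpha>\<close> is shifted up so that its values lie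
  between those of \<open>\<beta>\<close> and the new maximum.
\<close>
definition glue :: "nat list \<Rightarrow> nat list \<Rightarrow> nat list" where
  "glue \<alpha> \<beta> = map (\<lambda>x. x + length \<beta>) \<alpha> @ Suc (length \<alpha> + length \<beta>) # \<beta>"

lemma S132_iff: "\<sigma> \<in> S132 n \<longleftrightarrow> set \<sigma> = {1..n} \<and> distinct \<sigma> \<and> avoids_132 \<sigma>"
  by (auto simp: S132_def permutations_of_set_def)

lemma finite_S132 [simp]: "finite (S132 n)"
  by (simp add: S132_def)

lemma length_S132: "\<sigma> \<in> S132 n \<Longrightarrow> length \<sigma> = n"
  using distinct_card[of \<sigma>] by (simp add: S132_iff)

lemma S132_0: "S132 0 = {[]}"
  by (auto simp: S132_iff avoids_132_def)

lemma length_glue [simp]: "length (glue \<alpha> \<beta>) = Suc (length \<alpha> + length \<beta>)"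
  by (simp add: glue_def)

lemma nth_glue_left: "i < length \<alpha> \<Longrightarrow> glue \<alpha> \<beta> ! i = \<alpha> ! i + length \<beta>"
  by (simp add: glue_def nth_append)

lemma nth_glue_max: "glue \<alpha> \<beta> ! length \<alpha> = Suc (length \<alpha> + length \<beta>)"
  by (simp add: glue_def nth_append)

lemma nth_glue_right: "glue \<alpha> \<beta> ! (p + Suc (length \<alpha>)) = \<beta> ! p"
  by (simp add: glue_def nth_append)

lemma nth_bounds_S132:
  assumes "\<sigma> \<in> S132 n" "i < n"
  shows "1 \<le> \<sigma> ! i" "\<sigma> ! i \<le> n"
  using assms nth_mem[of i \<sigma>] length_S132[OF assms(1)] by (auto simp: S132_iff)

lemma glue_gt_right:
  assumes "\<alpha> \<in> S132 a" "\<beta> \<in> S132 b" "m \<le> a" "p < b"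
  shows "\<beta> ! p < glue \<alpha> \<beta> ! m"
proof (cases "m = a")
  case True
  then show ?thesis
    using nth_glue_max[of \<alpha> \<beta>] nth_bounds_S132(2)[OF assms(2,4)] length_S132[OF assms(1)]
      length_S132[OF assms(2)] by simp
next
  case False
  then show ?thesis
    using nth_glue_left[of m \<alpha> \<beta>] nth_bounds_S132(2)[OF assms(2,4)]
      nth_bounds_S132(1)[OF assms(1), of m] length_S132[OF assms(1)]
      length_S132[OF assms(2)] assms(3) by simp
qed

lemma avoids_132D:
  "avoids_132 \<sigma> \<Longrightarrow> i1 < i2 \<Longrightarrow> i2 < i3 \<Longrightarrow> i3 < length \<sigma> \<Longrightarrow>
    \<sigma> ! i1 < \<sigma> ! i3 \<Longrightarrow> \<sigma> ! i3 < \<sigma> ! i2 \<Longrightarrow> False"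
  unfolding avoids_132_def by blast

lemma avoids_132_appendD:
  assumes "avoids_132 (xs @ ys)"
  shows "avoids_132 xs" "avoids_132 ys"
proof -
  show "avoids_132 xs"
    unfolding avoids_132_def
  proof safe
    fix i1 i2 i3
    assume "i1 < i2" "i2 < i3" "i3 < length xs" "xs ! i1 < xs ! i3" "xs ! i3 < xs ! i2"
    then show False
      using avoids_132D[OF assms, of i1 i2 i3] by (simp add: nth_append)
  qed
  show "avoids_132 ys"
    unfolding avoids_132_def
  proof safe
    fix i1 i2 i3
    assume "i1 < i2" "i2 < i3" "i3 < length ys" "ys ! i1 < ys ! i3" "ys ! i3 < ys ! i2"
    then show False
      using avoids_132D[OF assms, of "length xs + i1" "length xs + i2" "length xs + i3"] by simp
  qed
qed

lemma avoids_132_map_strict_mono: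
  assumes "strict_mono_on (set \<sigma>) f"
  shows "avoids_132 (map f \<sigma>) \<longleftrightarrow> avoids_132 \<sigma>"
proof -
  have "f (\<sigma> ! i) < f (\<sigma> ! j) \<longleftrightarrow> \<sigma> ! i < \<sigma> ! j" if "i < length \<sigma>" "j < length \<sigma>" for i j
    using strict_mono_on_less[OF assms] that by simp
  then show ?thesis
    unfolding avoids_132_def by (auto 4 4)
qed

text \<open>
  An occurrence of 132 cannot have its last letter at the maximum. If the last letter lies in
  \<open>\<beta>\<close>, then so does the smaller first letter, as everything before \<open>\<beta>\<close> is larger than \<open>\<beta>\<close>. Hence
  an occurrence would lie completely in \<open>\<alpha>\<close> or completely in \<open>\<beta>\<close>.
\<close>
lemma glue_in_S132:
  assumes \<alpha>: "\<alpha> \<in> S132 a" and \<beta>: "\<beta> \<in> S132 b"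
  shows "glue \<alpha> \<beta> \<in> S132 (Suc (a + b))"
proof -
  note len = length_S132[OF \<alpha>] length_S132[OF \<beta>]
  have \<alpha>': "set \<alpha> = {1..a}" "distinct \<alpha>" "avoids_132 \<alpha>"
    and \<beta>': "set \<beta> = {1..b}" "distinct \<beta>" "avoids_132 \<beta>"
    using \<alpha> \<beta> by (simp_all add: S132_iff)
  have shift: "(\<lambda>x. x + b) ` {1..a} = {b + 1..b + a}"
    by (simp add: add.commute)
  have "set (glue \<alpha> \<beta>) = {1..Suc (a + b)}"
    using shift by (auto simp: glue_def len \<alpha>' \<beta>')
  moreover have "distinct (glue \<alpha> \<beta>)"
    by (auto simp: glue_def len \<alpha>' \<beta>' distinct_map inj_on_def)
  moreover have "avoids_132 (glue \<alpha> \<beta>)"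
    unfolding avoids_132_def
  proof safe
    fix i1 i2 i3
    assume i: "i1 < i2" "i2 < i3" "i3 < length (glue \<alpha> \<beta>)"
      and v: "glue \<alpha> \<beta> ! i1 < glue \<alpha> \<beta> ! i3" "glue \<alpha> \<beta> ! i3 < glue \<alpha> \<beta> ! i2"
    consider "i3 < a" | "i3 = a" | "i3 > a" by linarith
    then show False
    proof cases
      case 1
      then show False
        using avoids_132D[OF \<alpha>'(3) i(1,2)] i v by (simp add: nth_glue_left len)
    next
      case 2
      then show False
        using i v nth_glue_max[of \<alpha> \<beta>] nth_glue_left[of i2 \<alpha> \<beta>] nth_bounds_S132(2)[OF \<alpha>, of i2]
        by (simp add: len)
    next
      case 3
      define p3 where "p3 = i3 - Suc a"
      have p3: "i3 = p3 + Suc a" "p3 < b"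
        using 3 i(3) by (simp_all add: p3_def len)
      have g: "glue \<alpha> \<beta> ! (p + Suc a) = \<beta> ! p" for p
        using nth_glue_right[of \<alpha> \<beta> p] by (simp add: len)
      have "\<not> i1 \<le> a"
        using glue_gt_right[OF \<alpha> \<beta>, of i1 p3] v(1) p3 g by auto
      then obtain p1 p2 where "i1 = p1 + Suc a" "i2 = p2 + Suc a"
        using i(1) that[of "i1 - Suc a" "i2 - Suc a"] by simp
      then show False
        using avoids_132D[OF \<beta>'(3), of p1 p2 p3] i v p3 by (simp add: g len del: add_Suc_right)
    qed
  qed
  ultimately show ?thesis by (simp add: S132_iff)
qed

lemma glue_inject:
  assumes "glue \<alpha> \<beta> = glue \<alpha>' \<beta>'" "length \<alpha> = length \<alpha>'"
  shows "\<alpha> = \<alpha>' \<and> \<beta> = \<beta>'"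
proof -
  have "length \<beta> = length \<beta>'"
    using arg_cong[OF assms(1), of length] assms(2) by simp
  moreover have "inj (\<lambda>x::nat. x + length \<beta>')"
    by (simp add: inj_def)
  ultimately show ?thesis
    using assms by (auto simp: glue_def inj_map_eq_map)
qed

lemma down_closed_eq_interval:
  fixes B :: "nat set"
  assumes "finite B" "0 \<notin> B" "\<And>b c. b \<in> B \<Longrightarrow> 1 \<le> c \<Longrightarrow> c < b \<Longrightarrow> c \<in> B"
  shows "B = {1..card B}"
proof (cases "B = {}")
  case False
  have "B = {1..Max B}"
  proof
    show "B \<subseteq> {1..Max B}"
      using assms(1,2) by (auto simp: Suc_le_eq intro: gr0I)
    show "{1..Max B} \<subseteq> B"
      using Max_in[OF assms(1) False] assms(3) by (metis atLeastAtMost_iff le_neq_implies_less subsetI)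
  qed
  then show ?thesis
    by (metis card_atLeastAtMost diff_Suc_1)
qed auto

text \<open>
  Avoidance puts the entries before the maximum above those behind it. So the entries behind
  it are closed downwards among the positive integers, which determines both value sets.
\<close>
lemma S132_Suc_glueE:
  assumes "\<sigma> \<in> S132 (Suc n)"
  obtains j \<alpha> \<beta> where "j \<le> n" "\<alpha> \<in> S132 j" "\<beta> \<in> S132 (n - j)" "\<sigma> = glue \<alpha> \<beta>"
proof -
  have \<sigma>: "set \<sigma> = {1..Suc n}" "distinct \<sigma>" "avoids_132 \<sigma>"
    using assms by (simp_all add: S132_iff)
  then obtain us \<beta> where split: "\<sigma> = us @ Suc n # \<beta>"
    using split_list[of "Suc n" \<sigma>] by auto
  have dist: "distinct us" "distinct \<beta>" "set us \<inter> set \<beta> = {}" "Suc n \<notin> set us" "Suc n \<notin> set \<beta>"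
    using \<sigma>(2) by (auto simp: split)
  have un: "set us \<union> set \<beta> = {1..n}"
  proof -
    have "set us \<union> set \<beta> = {1..Suc n} - {Suc n}"
      using \<sigma>(1) dist by (auto simp: split)
    also have "{1..Suc n} - {Suc n} = {1..n}" by (simp add: atLeastAtMostSuc_conv)
    finally show ?thesis .
  qed
  have len: "length us + length \<beta> = n"
    using length_S132[OF assms] by (simp add: split)
  have gt: "b < u" if "u \<in> set us" "b \<in> set \<beta>" for u b
  proof (rule ccontr)
    assume "\<not> b < u"
    then have "u < b" using that dist(3) by (metis disjoint_iff linorder_neqE_nat)
    \<comment> \<open>\<open>u\<close>, the maximum and \<open>b\<close> form the pattern 132.\<close>
    obtain p where p: "p < length us" "us ! p = u" using \<open>u \<in> set us\<close> by (auto simp: in_set_conv_nth)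
    obtain q where q: "q < length \<beta>" "\<beta> ! q = b" using \<open>b \<in> set \<beta>\<close> by (auto simp: in_set_conv_nth)
    have "b \<in> {1..n}" using \<open>b \<in> set \<beta>\<close> un by blast
    then have "b < Suc n" by simp
    with \<open>u < b\<close> p q show False
      using avoids_132D[OF \<sigma>(3), of p "length us" "length us + Suc q"]
      by (simp add: split nth_append)
  qed
  have set\<beta>: "set \<beta> = {1..length \<beta>}"
  proof -
    have "set \<beta> = {1..card (set \<beta>)}"
    proof (rule down_closed_eq_interval)
      have "0 \<notin> {1..n}" by simp
      then show "0 \<notin> set \<beta>" using un by blast
      fix b c assume bc: "b \<in> set \<beta>" "1 \<le> c" "c < b"
      have "b \<in> {1..n}" using bc(1) un by blast
      then have "c \<in> set us \<union> set \<beta>" unfolding un using bc(2,3) by simp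
      then show "c \<in> set \<beta>"
        using gt[of c b] bc by (metis UnE less_asym)
    qed auto
    then show ?thesis using distinct_card[OF dist(2)] by simp
  qed
  have setus: "set us = {length \<beta> + 1..n}"
  proof -
    have "set us = {1..n} - {1..length \<beta>}" using un dist(3) set\<beta> by blast
    also have "\<dots> = {length \<beta> + 1..n}" by auto
    finally show ?thesis .
  qed
  define \<alpha> where "\<alpha> = map (\<lambda>x. x - length \<beta>) us"
  have us: "us = map (\<lambda>x. x + length \<beta>) \<alpha>"
    using setus unfolding \<alpha>_def map_map by (intro map_idI[symmetric]) auto
  have "strict_mono_on (set us) (\<lambda>x. x - length \<beta>)"
    using setus by (auto simp: strict_mono_on_def)
  then have av: "avoids_132 \<alpha>"
    using avoids_132_appendD(1)[of us "Suc n # \<beta>"] \<sigma>(3)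
    by (simp add: \<alpha>_def avoids_132_map_strict_mono split)
  have "distinct \<alpha>"
    using dist(1) us by (metis distinct_map)
  moreover have "set \<alpha> = {1..length us}"
  proof -
    have "{length \<beta> + 1..n} = (\<lambda>x. x + length \<beta>) ` {1..length us}"
      using len by (simp add: add.commute)
    then have "set \<alpha> = (\<lambda>x. x - length \<beta>) ` (\<lambda>x. x + length \<beta>) ` {1..length us}"
      using setus by (simp only: \<alpha>_def set_map)
    then show ?thesis by (simp only: image_image) simp
  qed
  ultimately have "\<alpha> \<in> S132 (length us)" using av by (simp add: S132_iff)
  moreover have "\<beta> \<in> S132 (n - length us)"
    using set\<beta> dist(2) avoids_132_appendD(2)[of "us @ [Suc n]" \<beta>] \<sigma>(3) len
    by (auto simp: S132_iff split)
  moreover have "\<sigma> = glue \<alpha> \<beta>"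
    using us len by (simp add: glue_def split \<alpha>_def)
  ultimately show ?thesis
    using len by (intro that[of "length us" \<alpha> \<beta>]) auto
qed

lemma sum_S132_Suc:
  fixes f :: "nat list \<Rightarrow> 'a::comm_monoid_add"
  shows "(\<Sum>\<sigma>\<in>S132 (Suc n). f \<sigma>)
    = (\<Sum>j\<le>n. \<Sum>\<alpha>\<in>S132 j. \<Sum>\<beta>\<in>S132 (n - j). f (glue \<alpha> \<beta>))"
proof -
  let ?I = "SIGMA j:{..n}. S132 j \<times> S132 (n - j)"
  let ?g = "\<lambda>(j :: nat, \<alpha>, \<beta>). glue \<alpha> \<beta>"
  have "inj_on ?g ?I"
  proof (rule inj_onI; clarsimp)
    fix j \<alpha> \<beta> j' \<alpha>' \<beta>'
    assume j: "j \<le> n" "j' \<le> n" and mem: "\<alpha> \<in> S132 j" "\<beta> \<in> S132 (n - j)"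
        "\<alpha>' \<in> S132 j'" "\<beta>' \<in> S132 (n - j')" and eq: "glue \<alpha> \<beta> = glue \<alpha>' \<beta>'"
    note len = length_S132[OF mem(1)] length_S132[OF mem(2)]
      length_S132[OF mem(3)] length_S132[OF mem(4)]
    \<comment> \<open>The position of the maximum determines the length of the left part.\<close>
    have no: False if h: "i < i'" "i' \<le> n" "\<gamma> \<in> S132 i" "\<delta> \<in> S132 (n - i)"
        "\<gamma>' \<in> S132 i'" "\<delta>' \<in> S132 (n - i')" "glue \<gamma> \<delta> = glue \<gamma>' \<delta>'" for i i' \<gamma> \<delta> \<gamma>' \<delta>'
      using nth_glue_max[of \<gamma> \<delta>] nth_glue_left[of i \<gamma>' \<delta>'] nth_bounds_S132(2)[OF h(5), of i] h
      by (simp add: length_S132)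
    have "j = j'"
      using no[OF _ j(2) mem eq] no[OF _ j(1) mem(3,4,1,2) eq[symmetric]] by (metis linorder_neqE_nat)
    then show "j = j' \<and> \<alpha> = \<alpha>' \<and> \<beta> = \<beta>'"
      using glue_inject[OF eq] len by simp
  qed
  moreover have "?g ` ?I = S132 (Suc n)"
  proof
    show "?g ` ?I \<subseteq> S132 (Suc n)"
      using glue_in_S132 by fastforce
    show "S132 (Suc n) \<subseteq> ?g ` ?I"
    proof
      fix \<sigma> assume "\<sigma> \<in> S132 (Suc n)"
      then obtain j \<alpha> \<beta> where "j \<le> n" "\<alpha> \<in> S132 j" "\<beta> \<in> S132 (n - j)" "\<sigma> = glue \<alpha> \<beta>"
        by (rule S132_Suc_glueE)
      then show "\<sigma> \<in> ?g ` ?I"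
        by (intro image_eqI[of _ _ "(j, \<alpha>, \<beta>)"]) auto
    qed
  qed
  ultimately have "(\<Sum>\<sigma>\<in>S132 (Suc n). f \<sigma>) = (\<Sum>x\<in>?I. f (?g x))"
    by (metis (no_types, lifting) sum.reindex_cong)
  also have "\<dots> = (\<Sum>j\<le>n. \<Sum>(\<alpha>, \<beta>)\<in>S132 j \<times> S132 (n - j). f (glue \<alpha> \<beta>))"
    by (subst sum.Sigma) (auto simp: case_prod_unfold)
  also have "\<dots> = (\<Sum>j\<le>n. \<Sum>\<alpha>\<in>S132 j. \<Sum>\<beta>\<in>S132 (n - j). f (glue \<alpha> \<beta>))"
    by (simp only: sum.cartesian_product)
  finally show ?thesis .
qed

lemma card_S132: "card (S132 n) = catalan n"
proof (induction n rule: less_induct)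
  case (less n)
  show ?case
  proof (cases n)
    case 0
    then show ?thesis by (simp add: S132_0)
  next
    case (Suc m)
    have "card (S132 n) = (\<Sum>j\<le>m. card (S132 j) * card (S132 (m - j)))"
      using sum_S132_Suc[of "\<lambda>_. 1 :: nat" m] by (simp add: Suc)
    also have "\<dots> = (\<Sum>j\<le>m. catalan j * catalan (m - j))"
      using less.IH by (intro sum.cong) (auto simp: Suc)
    finally show ?thesis by (simp add: catalan_convolution Suc)
  qed
qed

section \<open>Matches in the two halves\<close>

lemma matches_MMP_left_only:
  "matches_MMP 0 b c 0 \<sigma> i \<longleftrightarrow>
    b \<le> card {j. j < i \<and> \<sigma> ! j > \<sigma> ! i} \<and> c \<le> card {j. j < i \<and> \<sigma> ! j < \<sigma> ! i}"
  by (simp add: matches_MMP_def)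

lemma matches_MMP_glue_left:
  assumes "i < length \<alpha>"
  shows "matches_MMP 0 k l 0 (glue \<alpha> \<beta>) i \<longleftrightarrow> matches_MMP 0 k l 0 \<alpha> i"
proof -
  have "glue \<alpha> \<beta> ! j = \<alpha> ! j + length \<beta>" if "j \<le> i" for j
    using assms that by (simp add: nth_glue_left)
  then have "{j. j < i \<and> glue \<alpha> \<beta> ! j > glue \<alpha> \<beta> ! i} = {j. j < i \<and> \<alpha> ! j > \<alpha> ! i}"
    "{j. j < i \<and> glue \<alpha> \<beta> ! j < glue \<alpha> \<beta> ! i} = {j. j < i \<and> \<alpha> ! j < \<alpha> ! i}"
    by auto
  then show ?thesis by (simp add: matches_MMP_left_only)
qed

text \<open>
  The \<open>a\<close> entries of \<open>\<alpha>\<close> and the maximum precede \<open>\<beta>\<close> and exceed all of it: they supply \<open>a + 1\<close>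
  of the \<open>k\<close> larger entries asked for, and none of the smaller ones.
\<close>
lemma matches_MMP_glue_right:
  assumes \<alpha>: "\<alpha> \<in> S132 a" and \<beta>: "\<beta> \<in> S132 b" and p: "p < b"
  shows "matches_MMP 0 k l 0 (glue \<alpha> \<beta>) (p + Suc a) \<longleftrightarrow> matches_MMP 0 (k - Suc a) l 0 \<beta> p"
proof -
  have g: "glue \<alpha> \<beta> ! (q + Suc a) = \<beta> ! q" for q
    using nth_glue_right[of \<alpha> \<beta> q] length_S132[OF \<alpha>] by simp
  have big: "\<beta> ! p < glue \<alpha> \<beta> ! m" if "m \<le> a" for m
    using glue_gt_right[OF \<alpha> \<beta> that p] .
  have split: "{j. j < p + Suc a \<and> P j} = {j. j \<le> a \<and> P j} \<union> (\<lambda>q. q + Suc a) ` {q. q < p \<and> P (q + Suc a)}"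
    (is "?L = ?R") for P
  proof
    show "?L \<subseteq> ?R"
    proof
      fix j assume j: "j \<in> ?L"
      show "j \<in> ?R"
      proof (cases "j \<le> a")
        case False
        then have "j = (j - Suc a) + Suc a" by simp
        then show ?thesis using j False
          by (intro UnI2 image_eqI[of _ _ "j - Suc a"]) auto
      qed (use j in auto)
    qed
  qed auto
  have gr: "{j. j < p + Suc a \<and> glue \<alpha> \<beta> ! j > \<beta> ! p}
      = {..a} \<union> (\<lambda>q. q + Suc a) ` {q. q < p \<and> \<beta> ! q > \<beta> ! p}"
    using big by (subst split) (auto simp only: g)
  have less: "{j. j < p + Suc a \<and> glue \<alpha> \<beta> ! j < \<beta> ! p}
      = (\<lambda>q. q + Suc a) ` {q. q < p \<and> \<beta> ! q < \<beta> ! p}"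
    using big by (subst split) (auto simp only: g dest: less_asym)
  have inj: "inj_on (\<lambda>q. q + Suc a) A" for A
    by (simp add: inj_on_def)
  have "card {j. j < p + Suc a \<and> glue \<alpha> \<beta> ! j > \<beta> ! p} = Suc a + card {q. q < p \<and> \<beta> ! q > \<beta> ! p}"
    unfolding gr by (subst card_Un_disjoint) (auto simp: card_image[OF inj] simp del: add_Suc_right)
  moreover have "card {j. j < p + Suc a \<and> glue \<alpha> \<beta> ! j < \<beta> ! p} = card {q. q < p \<and> \<beta> ! q < \<beta> ! p}"
    unfolding less by (rule card_image[OF inj])
  ultimately show ?thesis
    unfolding matches_MMP_left_only g by auto
qed

lemma mmp_glue:
  assumes \<alpha>: "\<alpha> \<in> S132 a" and \<beta>: "\<beta> \<in> S132 b" and k: "k \<ge> 1"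
  shows "mmp 0 k l 0 (glue \<alpha> \<beta>) = mmp 0 k l 0 \<alpha> + mmp 0 (k - Suc a) l 0 \<beta>"
proof -
  note len = length_S132[OF \<alpha>] length_S132[OF \<beta>]
  let ?M = "matches_MMP 0 k l 0 (glue \<alpha> \<beta>)"
  let ?A = "{i. i < a \<and> matches_MMP 0 k l 0 \<alpha> i}"
  let ?B = "{p. p < b \<and> matches_MMP 0 (k - Suc a) l 0 \<beta> p}"
  have max: "\<not> ?M a"
  proof -
    have "glue \<alpha> \<beta> ! j < glue \<alpha> \<beta> ! a" if "j < a" for j
      using nth_glue_left[of j \<alpha> \<beta>] nth_glue_max[of \<alpha> \<beta>] nth_bounds_S132(2)[OF \<alpha> that] that
      by (simp add: len)
    then have none: "{j. j < a \<and> glue \<alpha> \<beta> ! a < glue \<alpha> \<beta> ! j} = {}"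
      by (auto dest: less_asym)
    show ?thesis
      unfolding matches_MMP_left_only none using k by simp
  qed
  have "{i. i < length (glue \<alpha> \<beta>) \<and> ?M i} = ?A \<union> (\<lambda>p. p + Suc a) ` ?B" (is "?L = ?R")
  proof
    show "?L \<subseteq> ?R"
    proof
      fix i assume i: "i \<in> ?L"
      consider "i < a" | "i = a" | "i > a" by linarith
      then show "i \<in> ?R"
      proof cases
        case 1
        then show ?thesis using i by (simp add: matches_MMP_glue_left len)
      next
        case 2
        then show ?thesis using i max by simp
      next
        case 3
        then have eq: "i = (i - Suc a) + Suc a" and lt: "i - Suc a < b"
          using i by (auto simp: len)
        have "?M ((i - Suc a) + Suc a)" using i eq by simp
        then have "i - Suc a \<in> ?B"
          using lt matches_MMP_glue_right[OF \<alpha> \<beta> lt] by blast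
        then show ?thesis using eq by blast
      qed
    qed
    show "?R \<subseteq> ?L"
      using matches_MMP_glue_right[OF \<alpha> \<beta>] matches_MMP_glue_left[of _ \<alpha> k l \<beta>] by (auto simp: len)
  qed
  then have "mmp 0 k l 0 (glue \<alpha> \<beta>) = card (?A \<union> (\<lambda>p. p + Suc a) ` ?B)"
    by (simp add: mmp_def)
  also have "\<dots> = card ?A + card ((\<lambda>p. p + Suc a) ` ?B)"
    by (rule card_Un_disjoint) auto
  also have "card ((\<lambda>p. p + Suc a) ` ?B) = card ?B"
    by (rule card_image) (simp add: inj_on_def)
  finally show ?thesis by (simp add: mmp_def len)
qed

lemma mmp_eq_0_of_short:
  assumes "length \<sigma> \<le> k"
  shows "mmp a k c d \<sigma> = 0"
proof -
  have "\<not> matches_MMP a k c d \<sigma> i" if "i < length \<sigma>" for i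
  proof -
    have "card {j. j < i \<and> \<sigma> ! j > \<sigma> ! i} \<le> card {..<i}"
      by (rule card_mono) auto
    then show ?thesis using that assms by (simp add: matches_MMP_def)
  qed
  then show ?thesis by (auto simp: mmp_def)
qed

section \<open>The generating function\<close>

text \<open>
  The value 1 that the definition of the series prescribes for the constant coefficient is also the
  contribution of the empty permutation, so the case distinction there can be dropped.
\<close>
lemma Qpoly_0: "Qpoly a b c d 0 = 1"
  by (simp add: Qpoly_def S132_0 mmp_def)

lemma Q132_nth: "fps_nth (Q132 a b c d) n = Qpoly a b c d n"
  by (simp add: Q132_def Qpoly_0)

lemma Qpoly_eq_catalan: "n \<le> k \<Longrightarrow> Qpoly a k c d n = of_nat (catalan n)"
  by (simp add: Qpoly_def mmp_eq_0_of_short length_S132 card_S132)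

lemma Qpoly_Suc:
  assumes "k \<ge> 1"
  shows "Qpoly 0 k l 0 (Suc n)
    = (\<Sum>j\<le>n. Qpoly 0 k l 0 j * Qpoly 0 (k - Suc j) l 0 (n - j))"
  unfolding Qpoly_def sum_S132_Suc sum_product
  using mmp_glue[OF _ _ assms] by (intro sum.cong refl) (simp add: mult_monom)

definition catalan_trunc :: "nat \<Rightarrow> 'a::comm_ring_1 fps" where
  "catalan_trunc m = (\<Sum>s<m. of_nat (catalan s) * fps_X ^ s)"

lemma catalan_trunc_nth:
  "fps_nth (catalan_trunc m :: 'a::comm_ring_1 fps) n = (if n < m then of_nat (catalan n) else 0)"
proof -
  have "fps_nth (of_nat (catalan s) * fps_X ^ s :: 'a fps) n
      = (if n = s then of_nat (catalan s) else 0)" for s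
    by (simp add: fps_X_power_nth flip: fps_of_nat)
  then show ?thesis
    by (simp add: catalan_trunc_def fps_sum_nth)
qed

text \<open>
  The truncated form of \<open>C = 1 + t C\<^sup>2\<close>: the products \<open>C\<^sub>j C\<^sub>s t^(j + s + 1)\<close> with
  \<open>j + s < m\<close> are exactly those of degree at most \<open>m\<close>.
\<close>
lemma catalan_trunc_Suc:
  "(catalan_trunc (Suc m) :: 'a::comm_ring_1 fps)
    = 1 + fps_X * (\<Sum>j<m. of_nat (catalan j) * fps_X ^ j * catalan_trunc (m - j))"
proof (induction m)
  case 0
  then show ?case by (simp add: catalan_trunc_def)
next
  case (Suc m)
  let ?c = "\<lambda>j. of_nat (catalan j) * fps_X ^ j :: 'a fps"
  have "(\<Sum>j<Suc m. ?c j * catalan_trunc (Suc m - j))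
      = (\<Sum>j<Suc m. ?c j * catalan_trunc (m - j) + of_nat (catalan j * catalan (m - j)) * fps_X ^ m)"
  proof (rule sum.cong[OF refl])
    fix j assume "j \<in> {..<Suc m}"
    then have j: "j \<le> m" by simp
    then have "catalan_trunc (Suc m - j) = catalan_trunc (m - j) + ?c (m - j)"
      by (simp add: Suc_diff_le catalan_trunc_def)
    moreover have "(fps_X :: 'a fps) ^ m = fps_X ^ j * fps_X ^ (m - j)"
      using j by (simp flip: power_add)
    ultimately show "?c j * catalan_trunc (Suc m - j)
        = ?c j * catalan_trunc (m - j) + of_nat (catalan j * catalan (m - j)) * fps_X ^ m"
      by (simp add: algebra_simps)
  qed
  also have "\<dots> = (\<Sum>j<m. ?c j * catalan_trunc (m - j))
      + of_nat (\<Sum>j\<le>m. catalan j * catalan (m - j)) * fps_X ^ m"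
    by (simp add: sum.distrib lessThan_Suc_atMost flip: sum_distrib_right)
       (simp add: catalan_trunc_def flip: lessThan_Suc_atMost)
  also have "(\<Sum>j\<le>m. catalan j * catalan (m - j)) = catalan (Suc m)"
    by (rule catalan_convolution)
  finally have "1 + fps_X * (\<Sum>j<Suc m. ?c j * catalan_trunc (Suc m - j))
      = catalan_trunc (Suc m) + ?c (Suc m)"
    unfolding Suc.IH by (simp add: algebra_simps)
  then show ?case by (simp add: catalan_trunc_def)
qed

text \<open>
  The cut at position \<open>j\<close> lowers the threshold \<open>m + 1\<close> to \<open>m - j\<close>. For \<open>j < m\<close> the left part is too
  short to contain a match and contributes a Catalan number; for \<open>j \<ge> m\<close> the threshold has reached
  0, so these cuts together contribute the tail of \<open>Q (Suc m)\<close> times \<open>Q 0\<close>.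
\<close>
lemma Q132_functional_equation:
  fixes l m :: nat
  defines "Q \<equiv> \<lambda>k. Q132 0 k l 0"
  shows "Q (Suc m) = 1 + fps_X *
    ((\<Sum>j<m. of_nat (catalan j) * fps_X ^ j * Q (m - j)) + (Q (Suc m) - catalan_trunc m) * Q 0)"
proof (rule fps_ext)
  fix n
  show "fps_nth (Q (Suc m)) n = fps_nth (1 + fps_X *
    ((\<Sum>j<m. of_nat (catalan j) * fps_X ^ j * Q (m - j)) + (Q (Suc m) - catalan_trunc m) * Q 0)) n"
  proof (cases n)
    case 0
    then show ?thesis by (simp add: Q_def Q132_nth Qpoly_0)
  next
    case (Suc n')
    let ?q = "\<lambda>k. Qpoly 0 k l 0"
    have small: "fps_nth (\<Sum>j<m. of_nat (catalan j) * fps_X ^ j * Q (m - j)) n'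
        = (\<Sum>j\<le>n'. if j < m then ?q (Suc m) j * ?q (m - j) (n' - j) else 0)"
    proof -
      have "fps_nth (\<Sum>j<m. of_nat (catalan j) * fps_X ^ j * Q (m - j)) n'
          = (\<Sum>j<m. if j \<le> n' then of_nat (catalan j) * ?q (m - j) (n' - j) else 0)"
        unfolding fps_sum_nth
        by (rule sum.cong) (auto simp: Q_def mult.assoc fps_X_power_mult_nth Q132_nth
            simp flip: fps_of_nat)
      also have "\<dots> = (\<Sum>j\<in>{..<m} \<inter> {..n'}. of_nat (catalan j) * ?q (m - j) (n' - j))"
        by (simp add: sum.inter_restrict)
      also have "\<dots> = (\<Sum>j\<in>{..n'} \<inter> {..<m}. ?q (Suc m) j * ?q (m - j) (n' - j))"
        by (rule sum.cong) (auto simp: Qpoly_eq_catalan)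
      finally show ?thesis by (simp add: sum.inter_restrict)
    qed
    have large: "fps_nth ((Q (Suc m) - catalan_trunc m) * Q 0) n'
        = (\<Sum>j\<le>n'. if j < m then 0 else ?q (Suc m) j * ?q (m - j) (n' - j))"
      unfolding fps_mult_nth atLeast0AtMost
      by (rule sum.cong) (auto simp: Q_def Q132_nth catalan_trunc_nth Qpoly_eq_catalan)
    have "fps_nth (Q (Suc m)) n = (\<Sum>j\<le>n'. ?q (Suc m) j * ?q (m - j) (n' - j))"
      using Qpoly_Suc[of "Suc m" l n'] by (simp add: Suc Q_def Q132_nth)
    also have "\<dots> = (\<Sum>j\<le>n'. if j < m then ?q (Suc m) j * ?q (m - j) (n' - j) else 0)
        + (\<Sum>j\<le>n'. if j < m then 0 else ?q (Suc m) j * ?q (m - j) (n' - j))"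
      unfolding sum.distrib[symmetric] by (rule sum.cong) auto
    finally show ?thesis
      using small large by (simp add: Suc)
  qed
qed

theorem theorem14:
  fixes k l :: nat
  assumes "k \<ge> 1" and "l \<ge> 1"
  shows "Q132 0 k l 0 =
    (of_nat (catalan (k - 1)) * fps_X ^ (k - 1)
      + (\<Sum>j<k - 1. of_nat (catalan j) * fps_X ^ j *
          (1 - fps_X * Q132 0 0 l 0
            + fps_X * (Q132 0 (k - j - 1) l 0
                - (\<Sum>s<k - j - 1. of_nat (catalan s) * fps_X ^ s)))))
    * fps_inverse_one (1 - fps_X * Q132 0 0 l 0)"
proof -
  obtain m where k: "k = Suc m" using assms(1) by (cases k) auto
  define Q where "Q = (\<lambda>k. Q132 0 k l 0)"
  define c where "c = (\<lambda>j. of_nat (catalan j) * fps_X ^ j :: int poly fps)"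
  have T: "catalan_trunc n = (\<Sum>s<n. c s)" for n
    by (simp add: catalan_trunc_def c_def)
  have fe: "Q (Suc m) * (1 - fps_X * Q 0)
      = 1 + fps_X * (\<Sum>j<m. c j * Q (m - j)) - fps_X * (\<Sum>j<m. c j) * Q 0"
    using Q132_functional_equation[of m l] unfolding T[symmetric]
    by (simp add: Q_def c_def algebra_simps)
  \<comment> \<open>Replacing the constant term 1 of the functional equation by truncated Catalan
    series produces the numerator in the required form.\<close>
  have one: "c m = 1 + fps_X * (\<Sum>j<m. c j * catalan_trunc (m - j)) - (\<Sum>j<m. c j)"
    using catalan_trunc_Suc[of m, where 'a = "int poly"] T[of "Suc m"]
    by (simp add: c_def algebra_simps)
  have "(\<Sum>j<m. c j * (1 - fps_X * Q 0 + fps_X * (Q (m - j) - catalan_trunc (m - j))))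
      = (\<Sum>j<m. c j) * (1 - fps_X * Q 0) + fps_X * (\<Sum>j<m. c j * Q (m - j))
        - fps_X * (\<Sum>j<m. c j * catalan_trunc (m - j))"
    by (simp add: algebra_simps sum.distrib sum_subtractf sum_distrib_left)
  then have "Q (Suc m) * (1 - fps_X * Q 0) = c m
      + (\<Sum>j<m. c j * (1 - fps_X * Q 0 + fps_X * (Q (m - j) - catalan_trunc (m - j))))"
    unfolding fe one by (simp add: algebra_simps)
  then have "Q (Suc m) = (c m
      + (\<Sum>j<m. c j * (1 - fps_X * Q 0 + fps_X * (Q (m - j) - catalan_trunc (m - j)))))
      * fps_inverse_one (1 - fps_X * Q 0)"
    using denominator_unit[of "Q 0"] by (metis mult.assoc mult.right_neutral)
  then show ?thesis
    by (simp add: k Q_def c_def catalan_trunc_def)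
qed

end
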